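(* Let $n\ge3$ be an odd integer, and let $u$ and $v$ be antipodal vertices of the cocktail party graph $\overline{nK_2}$. Then there is pretty good state transfer between $(u,0)$ and $(v,0)$ in $\overline{nK_2}\circ K_1$.
   Context: $\overline{nK_2}$ is the complement of the disjoint union of $n$ copies of $K_2$; two of its vertices are antipodal if they are at distance $2$ (the diameter), i.e. distinct and non-adjacent. $K_1$ is the one-vertex graph. The corona $G\circ H$ of graphs $G,H$ has vertex set $V(G)\times(\{0\}\cup V(H))$ (where $0\notin V(H)$), and $(v,w)$ is adjacent to $(v',w')$ iff one of the following holds: $w=w'=0$ and $v,v'$ are adjacent in $G$; or $v=v'$ and $w,w'\in V(H)$ are adjacent in $H$; or $v=v'$ and exactly one of $w,w'$ equals $0$. A graph $X$ with adjacency matrix $A(X)$ has pretty good state transfer between vertices $a,b$ if for every $\epsilon>0$ there are a time $\tau$ and a complex number $\gamma$ with $|\gamma|=1$ such that $\|e^{-\mathrm{i}\tau A(X)}e_a-\gamma e_b\|<\epsilon$, where $e_a$ is the standard basis vector indexed by $a$. *)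

theory Defs
  imports "HOL-Analysis.Analysis" "Graph_Theory.Graph_Theory"
begin

text \<open>
  Finite simple graphs are the graphs of locale \<^locale>\<open>pair_graph\<close>: an edge joining \<open>u\<close> and \<open>v\<close>
  is represented by the two arcs \<open>(u, v)\<close> and \<open>(v, u)\<close>.
\<close>

definition complete_graph :: "'a set \<Rightarrow> 'a pair_pre_digraph" where
  "complete_graph V = \<lparr>pverts = V, parcs = {(u, v). u \<in> V \<and> v \<in> V \<and> u \<noteq> v}\<rparr>"

lemma complete_graph_complete_digraph:
  "finite V \<Longrightarrow> K\<^bsub>card V\<^esub> (with_proj (complete_graph V))"
  by (auto simp: complete_digraph_pair_def complete_graph_def)

definition K1 :: "unit pair_pre_digraph" where
  "K1 = complete_graph UNIV"

definition K2 :: "bool pair_pre_digraph" where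
  "K2 = complete_graph UNIV"

definition complement_graph :: "'a pair_pre_digraph \<Rightarrow> 'a pair_pre_digraph" where
  "complement_graph G = \<lparr>pverts = pverts G,
     parcs = {(u, v). u \<in> pverts G \<and> v \<in> pverts G \<and> u \<noteq> v \<and> (u, v) \<notin> parcs G}\<rparr>"

text \<open>The disjoint union of copies of \<open>G\<close>, one for each index in \<open>I\<close>.\<close>

definition copies :: "'i set \<Rightarrow> 'a pair_pre_digraph \<Rightarrow> ('i \<times> 'a) pair_pre_digraph" where
  "copies I G = \<lparr>pverts = I \<times> pverts G,
     parcs = {((i, x), (j, y)). i \<in> I \<and> i = j \<and> (x, y) \<in> parcs G}\<rparr>"

text \<open>\<open>n\<close> is the cardinality of the index type \<open>'n\<close>.\<close>

definition cocktail_party :: "('n::finite \<times> bool) pair_pre_digraph" where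
  "cocktail_party = complement_graph (copies UNIV K2)"

text \<open>
  In \<open>V(G) \<times> ({0} \<union> V(H))\<close> the extra element \<open>0\<close> is \<^const>\<open>None\<close>, and a vertex \<open>w\<close> of \<open>H\<close>
  is \<open>Some w\<close>.
\<close>

definition corona ::
  "'a pair_pre_digraph \<Rightarrow> 'b pair_pre_digraph \<Rightarrow> ('a \<times> 'b option) pair_pre_digraph" where
  "corona G H = \<lparr>pverts = pverts G \<times> insert None (Some ` pverts H),
     parcs = {((v, w), (v', w')).
       v \<in> pverts G \<and> v' \<in> pverts G \<and>
       w \<in> insert None (Some ` pverts H) \<and> w' \<in> insert None (Some ` pverts H) \<and>
       (w = None \<and> w' = None \<and> (v, v') \<in> parcs G \<or>
        v = v' \<and> (\<exists>x y. w = Some x \<and> w' = Some y \<and> (x, y) \<in> parcs H) \<or>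
        v = v' \<and> (w = None \<longleftrightarrow> w' \<noteq> None))}\<rparr>"

lemma pair_graphI:
  assumes "finite (pverts G)" "parcs G \<subseteq> pverts G \<times> pverts G" "sym (parcs G)" "irrefl (parcs G)"
  shows "pair_graph G"
proof
  show "finite (parcs G)"
    using assms(1,2) finite_subset by blast
qed (use assms in \<open>auto simp: symmetric_def irrefl_def\<close>)

lemma pair_graphD:
  assumes "pair_graph G"
  shows "finite (pverts G)" "parcs G \<subseteq> pverts G \<times> pverts G" "sym (parcs G)" "irrefl (parcs G)"
proof -
  interpret pair_graph G by fact
  show "finite (pverts G)" by (rule pair_finite_verts)
  show "parcs G \<subseteq> pverts G \<times> pverts G" using in_arcsD1 in_arcsD2 by auto
  show "sym (parcs G)" using pair_sym_arcs by (simp add: symmetric_def)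
  show "irrefl (parcs G)" using pair_no_loops by (force simp: irrefl_def)
qed

lemma pair_graph_complete_graph: "finite V \<Longrightarrow> pair_graph (complete_graph V)"
  by (rule pair_graphI) (auto simp: complete_graph_def sym_def irrefl_def)

lemma pair_graph_complement_graph: "pair_graph G \<Longrightarrow> pair_graph (complement_graph G)"
  by (frule pair_graphD(3), drule pair_graphD(1), rule pair_graphI)
    (auto simp: complement_graph_def sym_def irrefl_def)

lemma pair_graph_copies:
  assumes "finite I" "pair_graph G"
  shows "pair_graph (copies I G)"
  using assms(1) pair_graphD[OF assms(2)]
  by (intro pair_graphI) (auto simp: copies_def sym_def irrefl_def)

lemma pair_graph_corona:
  assumes "pair_graph G" "pair_graph H"
  shows "pair_graph (corona G H)"
  using pair_graphD[OF assms(1)] pair_graphD[OF assms(2)]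
  by (intro pair_graphI) (auto simp: corona_def sym_def irrefl_def)

lemma pair_graph_cocktail_party: "pair_graph cocktail_party"
  by (simp add: cocktail_party_def K2_def pair_graph_complement_graph pair_graph_copies
      pair_graph_complete_graph)

definition graph_dist :: "'a pair_pre_digraph \<Rightarrow> 'a \<Rightarrow> 'a \<Rightarrow> ereal" where
  "graph_dist G u v = wf_digraph.\<mu> (with_proj G) (\<lambda>_. 1) u v"

definition graph_diameter :: "'a pair_pre_digraph \<Rightarrow> ereal" where
  "graph_diameter G = (SUP (u, v) \<in> pverts G \<times> pverts G. graph_dist G u v)"

definition antipodal :: "'a pair_pre_digraph \<Rightarrow> 'a \<Rightarrow> 'a \<Rightarrow> bool" where
  "antipodal G u v \<longleftrightarrow>
     u \<in> pverts G \<and> v \<in> pverts G \<and> graph_dist G u v = graph_diameter G"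

lemma cocktail_party_simps:
  "pverts cocktail_party = UNIV"
  "(u, v) \<in> parcs cocktail_party \<longleftrightarrow> fst u \<noteq> fst v"
  by (auto simp: cocktail_party_def complement_graph_def copies_def K2_def complete_graph_def prod_eq_iff
      split: prod.splits)

lemma graph_dist_cocktail_party:
  assumes "CARD('n::finite) \<ge> 2"
  shows "graph_dist cocktail_party u (v :: 'n \<times> bool) =
    (if u = v then 0 else if (u, v) \<in> parcs cocktail_party then 1 else 2)"
proof -
  let ?G = "cocktail_party :: ('n \<times> bool) pair_pre_digraph"
  interpret pair_graph ?G by (rule pair_graph_cocktail_party)
  have cost: "awalk_cost (\<lambda>_. 1) p = real (length p)" for p :: "(('n \<times> bool) \<times> ('n \<times> bool)) list"
    by (induction p) auto
  have dist: "graph_dist ?G u v = (INF p\<in>{p. awalk u p v}. ereal (real (length p)))"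
    by (simp add: graph_dist_def \<mu>_def cost)
  have walk: "awalk u p v \<longleftrightarrow> set p \<subseteq> parcs ?G \<and> pcas u p v" for p
    by (simp add: awalk_def cocktail_party_simps)
  have eq: "graph_dist ?G u v = ereal (real (length p))"
    if "awalk u p v" "\<And>q. awalk u q v \<Longrightarrow> length p \<le> length q" for p
    unfolding dist using that by (intro antisym INF_lower2[of p] INF_greatest) auto
  consider "u = v" | "u \<noteq> v" "(u, v) \<in> parcs ?G" | "u \<noteq> v" "(u, v) \<notin> parcs ?G" by blast
  then show ?thesis
  proof cases
    case 1
    then show ?thesis using eq[of "[]"] by (simp add: awalk_def cocktail_party_simps zero_ereal_def)
  next
    case 2
    have "1 \<le> length q" if "awalk u q v" for q
      using that 2 by (cases q) (auto simp: walk)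
    then show ?thesis using eq[of "[(u, v)]"] 2 by (simp add: walk)
  next
    case 3
    have "2 \<le> length q" if "awalk u q v" for q
    proof (cases q)
      case (Cons e r)
      then show ?thesis using that 3 by (cases r) (auto simp: walk)
    qed (use that 3 in \<open>auto simp: walk\<close>)
    moreover obtain k where k: "k \<noteq> fst u"
    proof -
      have "UNIV \<noteq> {fst u}" using assms by (metis card_1_singleton_iff One_nat_def
            not_less_eq_eq numeral_2_eq_2 order_refl)
      then show thesis using that by blast
    qed
    moreover have "fst u = fst v"
      using 3 by (simp add: cocktail_party_simps)
    moreover have "(u, (k, True)) \<in> parcs ?G" "((k, True), v) \<in> parcs ?G"
      using calculation by (auto simp: cocktail_party_simps)
    ultimately have "graph_dist ?G u v = ereal (real (length [(u, (k, True)), ((k, True), v)]))"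
      by (intro eq) (simp add: walk, force)
    then show ?thesis using 3 by simp
  qed
qed

lemma graph_diameter_cocktail_party:
  assumes "CARD('n::finite) \<ge> 2"
  shows "graph_diameter (cocktail_party :: ('n \<times> bool) pair_pre_digraph) = 2"
proof (rule antisym)
  show "graph_diameter (cocktail_party :: ('n \<times> bool) pair_pre_digraph) \<le> 2"
    unfolding graph_diameter_def
    by (rule SUP_least) (auto simp: graph_dist_cocktail_party[OF assms])
  have "graph_dist cocktail_party (undefined :: 'n, True) (undefined, False) = 2"
    by (simp add: graph_dist_cocktail_party[OF assms] cocktail_party_simps)
  then show "2 \<le> graph_diameter (cocktail_party :: ('n \<times> bool) pair_pre_digraph)"
    unfolding graph_diameter_def
    by (intro SUP_upper2[of "((undefined, True), (undefined, False))"])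
      (auto simp: cocktail_party_simps)
qed

lemma antipodal_cocktail_party:
  fixes u v :: "'n::finite \<times> bool"
  assumes "CARD('n) \<ge> 2"
  shows "antipodal cocktail_party u v \<longleftrightarrow> graph_dist cocktail_party u v = 2"
    and "antipodal cocktail_party u v \<longleftrightarrow> u \<noteq> v \<and> (u, v) \<notin> parcs cocktail_party"
  by (simp_all add: antipodal_def graph_diameter_cocktail_party[OF assms]
      graph_dist_cocktail_party[OF assms] cocktail_party_simps)

text \<open>
  A vertex set is a subset of a finite type, and matrices are indexed by the whole type. Rows and
  columns of elements that are not vertices are zero, so they do not affect the vertices.
\<close>

definition adjacency_matrix :: "'a::finite pair_pre_digraph \<Rightarrow> complex^'a^'a" where
  "adjacency_matrix G = (\<chi> u v. if (u, v) \<in> parcs G then 1 else 0)"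

text \<open>The type of square matrices carries the componentwise product, so neither \<open>^\<close> nor
  \<^const>\<open>exp\<close> applies to matrices.\<close>

definition matrix_pow :: "complex^'a^'a \<Rightarrow> nat \<Rightarrow> complex^'a^'a" where
  "matrix_pow A k = (((**) A) ^^ k) (mat 1)"

definition matrix_exp :: "complex^'a^'a \<Rightarrow> complex^'a^'a" where
  "matrix_exp A = (\<Sum>k. (1 / fact k) *\<^sub>R matrix_pow A k)"

lemma summable_matrix_exp: "summable (\<lambda>k. (1 / fact k) *\<^sub>R matrix_pow A k)"
  for A :: "complex^'a::finite^'a"
proof -
  define M where "M = (\<Sum>i\<in>UNIV. \<Sum>j\<in>UNIV. norm (A $ i $ j))"
  have rows: "(\<Sum>j\<in>UNIV. norm (A $ i $ j)) \<le> M" for i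
    unfolding M_def by (rule member_le_sum) (auto intro: sum_nonneg)
  have M0: "M \<ge> 0" unfolding M_def by (intro sum_nonneg) auto
  have bound: "norm (matrix_pow A k $ i $ j) \<le> M ^ k" for k i j
  proof (induction k arbitrary: i)
    case 0
    show ?case by (simp add: matrix_pow_def mat_def)
  next
    case (Suc k)
    have "norm (matrix_pow A (Suc k) $ i $ j) = norm (\<Sum>l\<in>UNIV. A $ i $ l * matrix_pow A k $ l $ j)"
      by (simp add: matrix_pow_def matrix_matrix_mult_def)
    also have "\<dots> \<le> (\<Sum>l\<in>UNIV. norm (A $ i $ l) * M ^ k)"
      by (rule sum_norm_le) (simp add: norm_mult mult_left_mono Suc.IH)
    also have "\<dots> = (\<Sum>l\<in>UNIV. norm (A $ i $ l)) * M ^ k" by (simp add: sum_distrib_right)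
    also have "\<dots> \<le> M * M ^ k" by (intro mult_right_mono rows) (simp add: M0)
    finally show ?case by simp
  qed
  define C where "C = real (CARD('a)) * real (CARD('a))"
  have nrm: "norm (matrix_pow A k) \<le> C * M ^ k" for k
  proof -
    have "norm (matrix_pow A k) \<le> (\<Sum>i\<in>UNIV. norm (matrix_pow A k $ i))"
      unfolding norm_vec_def by (rule L2_set_le_sum) auto
    also have "\<dots> \<le> (\<Sum>i\<in>UNIV. \<Sum>j\<in>UNIV. norm (matrix_pow A k $ i $ j))"
      by (rule sum_mono, subst norm_vec_def, rule L2_set_le_sum) auto
    also have "\<dots> \<le> (\<Sum>i\<in>(UNIV::'a set). \<Sum>j\<in>(UNIV::'a set). M ^ k)"
      by (intro sum_mono bound)
    finally show ?thesis by (simp add: C_def)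
  qed
  show ?thesis
  proof (rule summable_comparison_test')
    show "summable (\<lambda>k. C * (inverse (fact k) * M ^ k))"
      by (rule summable_mult) (rule summable_exp)
    show "norm ((1 / fact k) *\<^sub>R matrix_pow A k) \<le> C * (inverse (fact k) * M ^ k)" for k
      using mult_left_mono[OF nrm[of k], of "inverse (fact k)"]
      by (simp add: field_simps)
  qed
qed

text \<open>The norm is the Euclidean one, \<open>axis a 1\<close> is \<open>e\<^sub>a\<close>, and \<open>mat c ** A\<close> is the scalar multiple
  \<open>c A\<close>.\<close>

definition pretty_good_state_transfer :: "'a::finite pair_pre_digraph \<Rightarrow> 'a \<Rightarrow> 'a \<Rightarrow> bool" where
  "pretty_good_state_transfer X a b \<longleftrightarrow>
     (\<forall>\<epsilon>>0. \<exists>(\<tau>::real) (\<gamma>::complex). cmod \<gamma> = 1 \<and>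
        norm (matrix_exp (mat (- (\<i> * of_real \<tau>)) ** adjacency_matrix X) *v axis a 1
              - \<gamma> *s axis b 1) < \<epsilon>)"

end

theory Submission
  imports Defs
begin

text \<open>
  Let \<open>A\<close> be the adjacency matrix of a graph \<open>G\<close>. If \<open>A z = \<mu> z\<close> and \<open>\<theta>\<close> is one of the two roots of
  \<open>\<theta>\<^sup>2 = \<mu> \<theta> + 1\<close>, then the vector that is \<open>\<theta> z\<close> on the vertices of \<open>G\<close> and \<open>z\<close> on the pendant
  vertices is an eigenvector of the corona of \<open>G\<close> with \<open>K\<^sub>1\<close> for the eigenvalue \<open>\<theta>\<close>.
  The cocktail party graph has the eigenvalues \<open>2n - 2\<close>, \<open>0\<close> and \<open>-2\<close>. For antipodal \<open>u\<close>, \<open>v\<close> the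
  components of \<open>e\<^sub>u\<close> and \<open>e\<^sub>v\<close> in the eigenspaces of \<open>2n - 2\<close> and \<open>-2\<close> agree, and those in the
  eigenspace of \<open>0\<close> are negatives of each other. The resulting eigenvalues of the corona are
  \<open>\<plusminus>1\<close> (from \<open>0\<close>), \<open>-1 \<plusminus> sqrt 2\<close> (from \<open>-2\<close>) and \<open>(n - 1) \<plusminus> sqrt M\<close> with \<open>M = (n - 1)\<^sup>2 + 1\<close>.

  At a time \<open>\<tau> = 2 \<pi> k\<close> with integral \<open>k\<close>, the phases \<open>exp (- \<i> \<tau> \<theta>)\<close> of \<open>\<theta> = \<plusminus>1\<close> are exactly \<open>1\<close>,
  and the other four are close to \<open>-1\<close> as soon as \<open>k sqrt 2\<close> and \<open>k sqrt M\<close> are both close to \<open>1/2\<close>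
  modulo \<open>1\<close>; the evolution then takes \<open>(u, 0)\<close> close to \<open>- (v, 0)\<close>. By Kronecker's theorem such \<open>k\<close>
  exist if \<open>1\<close>, \<open>sqrt 2\<close> and \<open>sqrt M\<close> are linearly independent over the integers
  (\<open>approx_half_sqrts\<close>). This holds if neither \<open>M\<close> nor \<open>2 M\<close> is a square. The first is never a
  square for \<open>n \<ge> 2\<close>; the second is not one because \<open>M\<close> is odd for odd \<open>n\<close>.
\<close>

section \<open>State transfer from a decomposition into eigenvectors\<close>

lemma matrix_pow_eigenvector:
  fixes A :: "complex^'a::finite^'a"
  assumes "A *v x = \<theta> *s x"
  shows "matrix_pow (mat c ** A) k *v x = (c * \<theta>) ^ k *s x"
proof (induction k)
  case 0
  show ?case by (simp add: matrix_pow_def)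
next
  case (Suc k)
  have scale: "mat c *v y = c *s y" for y :: "complex^'a"
    by (simp add: vec_eq_iff matrix_vector_mult_def mat_def if_distrib[of "\<lambda>z. z * _"] cong: if_cong)
  have "matrix_pow (mat c ** A) (Suc k) *v x = (mat c ** A) *v (matrix_pow (mat c ** A) k *v x)"
    by (simp add: matrix_pow_def matrix_vector_mul_assoc)
  also have "\<dots> = (c * \<theta>) ^ Suc k *s x"
    by (simp add: Suc.IH vector_scalar_commute flip: matrix_vector_mul_assoc)
      (simp add: assms scale mult_ac)
  finally show ?case .
qed

lemma matrix_exp_eigenvector:
  fixes A :: "complex^'a::finite^'a"
  assumes "A *v x = \<theta> *s x"
  shows "matrix_exp (mat c ** A) *v x = exp (c * \<theta>) *s x"
proof -
  have "linear (\<lambda>M :: complex^'a^'a. M *v x)"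
    by (rule linearI)
      (simp_all add: vec_eq_iff matrix_vector_mult_def distrib_right sum.distrib scaleR_sum_right)
  then have "bounded_linear (\<lambda>M :: complex^'a^'a. M *v x)"
    by (simp add: linear_conv_bounded_linear)
  then have "matrix_exp (mat c ** A) *v x
      = (\<Sum>k. ((1 / fact k) *\<^sub>R matrix_pow (mat c ** A) k) *v x)"
    unfolding matrix_exp_def by (rule bounded_linear.suminf) (rule summable_matrix_exp)
  also have "\<dots> = (\<Sum>k. ((c * \<theta>) ^ k /\<^sub>R fact k) *s x)"
    by (intro suminf_cong, simp add: linear_scale[OF \<open>linear _\<close>] matrix_pow_eigenvector[OF assms])
       (simp add: vec_eq_iff inverse_eq_divide)
  also have "\<dots> = exp (c * \<theta>) *s x"
  proof -
    have "linear (\<lambda>z :: complex. z *s x)"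
      by (rule linearI) (simp_all add: vec_eq_iff distrib_right)
    then have "bounded_linear (\<lambda>z :: complex. z *s x)"
      by (simp add: linear_conv_bounded_linear)
    then show ?thesis
      unfolding exp_def by (rule bounded_linear.suminf[symmetric]) (rule summable_exp_generic)
  qed
  finally show ?thesis .
qed

text \<open>
  It suffices to write \<open>e\<^sub>a\<close> as a sum of eigenvectors, not necessarily orthogonal, so that \<open>e\<^sub>b\<close> is the
  same sum with the summands multiplied by numbers \<open>\<sigma>\<close>, and to approximate these numbers, up to a
  common phase, by the phases of the eigenvalues.
\<close>

lemma pretty_good_state_transfer_eigenvectors:
  fixes X :: "'a::finite pair_pre_digraph" and w :: "'i \<Rightarrow> complex^'a"
  assumes "finite I"
    and eig: "\<And>i. i \<in> I \<Longrightarrow> adjacency_matrix X *v w i = of_real (\<theta> i) *s w i"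
    and a: "axis a 1 = (\<Sum>i\<in>I. w i)"
    and b: "axis b 1 = (\<Sum>i\<in>I. \<sigma> i *s w i)"
    and approx: "\<And>\<delta>. \<delta> > 0 \<Longrightarrow> \<exists>\<tau> \<gamma>. cmod \<gamma> = 1 \<and>
      (\<forall>i\<in>I. cmod (exp (- (\<i> * of_real \<tau>) * of_real (\<theta> i)) - \<gamma> * \<sigma> i) < \<delta>)"
  shows "pretty_good_state_transfer X a b"
  unfolding pretty_good_state_transfer_def
proof (intro allI impI)
  fix \<epsilon> :: real
  assume "\<epsilon> > 0"
  define C where "C = (\<Sum>i\<in>I. norm (w i)) + 1"
  have "C > 0"
    unfolding C_def by (intro add_nonneg_pos sum_nonneg) auto
  obtain \<tau> \<gamma> where \<gamma>: "cmod \<gamma> = 1"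
    and close: "\<And>i. i \<in> I \<Longrightarrow> cmod (exp (- (\<i> * of_real \<tau>) * of_real (\<theta> i)) - \<gamma> * \<sigma> i) < \<epsilon> / C"
    using approx[of "\<epsilon> / C"] \<open>\<epsilon> > 0\<close> \<open>C > 0\<close> by auto
  let ?U = "matrix_exp (mat (- (\<i> * of_real \<tau>)) ** adjacency_matrix X)"
  let ?e = "\<lambda>i. exp (- (\<i> * of_real \<tau>) * of_real (\<theta> i))"
  have norm_scale: "norm (z *s y) = cmod z * norm y" for z and y :: "complex^'a"
    by (simp add: norm_vec_def norm_mult L2_set_right_distrib)
  have "?U *v axis a 1 - \<gamma> *s axis b 1 = (\<Sum>i\<in>I. ?e i *s w i) - \<gamma> *s (\<Sum>i\<in>I. \<sigma> i *s w i)"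
    unfolding a b vec.linear_sum[OF matrix_vector_mul_linear_gen]
    by (simp add: matrix_exp_eigenvector[OF eig])
  also have "\<dots> = (\<Sum>i\<in>I. (?e i - \<gamma> * \<sigma> i) *s w i)"
    by (simp add: vec.scale_sum_right vec.scale_left_diff_distrib sum_subtractf)
  also have "norm \<dots> \<le> (\<Sum>i\<in>I. \<epsilon> / C * norm (w i))"
    by (intro sum_norm_le, unfold norm_scale, intro mult_right_mono less_imp_le[OF close] norm_ge_zero)
  also have "\<dots> = \<epsilon> / C * (C - 1)"
    by (simp add: C_def sum_distrib_left)
  also have "\<dots> < \<epsilon>"
    using \<open>\<epsilon> > 0\<close> \<open>C > 0\<close> by (simp add: field_simps)
  finally show "\<exists>\<tau> \<gamma>. cmod \<gamma> = 1 \<and>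
      norm (matrix_exp (mat (- (\<i> * of_real \<tau>)) ** adjacency_matrix X) *v axis a 1 - \<gamma> *s axis b 1) < \<epsilon>"
    using \<gamma> by blast
qed

section \<open>Eigenvectors of the corona with a single vertex\<close>

text \<open>The vector that is \<open>\<theta> z\<close> on the vertices \<open>(v, None)\<close> and \<open>z\<close> on the pendant vertices.\<close>

definition corona_vec :: "complex \<Rightarrow> complex^'a \<Rightarrow> complex^('a::finite \<times> unit option)" where
  "corona_vec \<theta> z = (\<chi> p. if snd p = None then \<theta> * z $ fst p else z $ fst p)"

lemma corona_K1_eigenvector:
  fixes G :: "'a::finite pair_pre_digraph"
  assumes "pverts G = UNIV" and z: "adjacency_matrix G *v z = \<mu> *s z" and \<theta>: "\<theta> * \<theta> = \<mu> * \<theta> + 1"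
  shows "adjacency_matrix (corona G K1) *v corona_vec \<theta> z = \<theta> *s corona_vec \<theta> z"
proof -
  have z': "(\<Sum>y\<in>UNIV. adjacency_matrix G $ x $ y * z $ y) = \<mu> * z $ x" for x
    using arg_cong[OF z, of "\<lambda>y. y $ x"] by (simp add: matrix_vector_mult_def)
  have sum_pair: "(\<Sum>p\<in>UNIV. f p) = (\<Sum>y\<in>UNIV. f (y, None) + f (y, Some ()))"
    for f :: "'a \<times> unit option \<Rightarrow> complex"
    by (simp add: UNIV_option_conv UNIV_unit sum.cartesian_product' flip: UNIV_Times_UNIV)
  have arcs: "((x, None), (y, None)) \<in> parcs (corona G K1) \<longleftrightarrow> (x, y) \<in> parcs G"
    "((x, None), (y, Some ())) \<in> parcs (corona G K1) \<longleftrightarrow> x = y"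
    "((x, Some ()), (y, None)) \<in> parcs (corona G K1) \<longleftrightarrow> x = y"
    "((x, Some ()), (y, Some ())) \<notin> parcs (corona G K1)" for x y
    by (auto simp: corona_def K1_def complete_graph_def assms(1))
  have "(adjacency_matrix (corona G K1) *v corona_vec \<theta> z) $ (x, None) = \<theta> * (\<theta> * z $ x)" for x
  proof -
    have "(adjacency_matrix (corona G K1) *v corona_vec \<theta> z) $ (x, None)
        = \<theta> * (\<Sum>y\<in>UNIV. adjacency_matrix G $ x $ y * z $ y) + z $ x"
      by (simp add: matrix_vector_mult_def sum_pair adjacency_matrix_def arcs corona_vec_def
          sum.distrib sum_distrib_left if_distrib[of "\<lambda>a. a * _"] if_distrib[of "\<lambda>a. _ * a"] cong: if_cong)
    also have "\<dots> = (\<mu> * \<theta> + 1) * z $ x"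
      unfolding z' by (simp add: algebra_simps)
    finally show ?thesis by (simp flip: \<theta>)
  qed
  moreover have "(adjacency_matrix (corona G K1) *v corona_vec \<theta> z) $ (x, Some ()) = \<theta> * z $ x" for x
    by (simp add: matrix_vector_mult_def sum_pair adjacency_matrix_def arcs corona_vec_def
          if_distrib[of "\<lambda>a. a * _"] cong: if_cong)
  ultimately show ?thesis
    by (auto simp: vec_eq_iff corona_vec_def)
qed

text \<open>The two roots \<open>\<theta>\<close> of \<open>\<theta>\<^sup>2 = \<mu> \<theta> + 1\<close>; the flag selects the sign of the square root.\<close>

definition corona_eigenvalue :: "real \<Rightarrow> bool \<Rightarrow> real" where
  "corona_eigenvalue \<mu> s = (\<mu> + (if s then 1 else - 1) * sqrt (\<mu>\<^sup>2 + 4)) / 2"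

lemma corona_eigenvalue_quadratic:
  "corona_eigenvalue \<mu> s * corona_eigenvalue \<mu> s = \<mu> * corona_eigenvalue \<mu> s + 1"
proof -
  have "sqrt (\<mu>\<^sup>2 + 4) * sqrt (\<mu>\<^sup>2 + 4) = \<mu> * \<mu> + 4"
    by (simp add: power2_eq_square)
  then show ?thesis
    by (cases s) (simp_all add: corona_eigenvalue_def field_simps)
qed

text \<open>
  Here \<open>x \<mu>\<close> is the component of \<open>e\<^sub>u\<close> in the eigenspace of \<open>\<mu>\<close>, and \<open>\<sigma> \<mu>\<close> relates it to the component
  of \<open>e\<^sub>v\<close>. Each component gives two eigenvectors of the corona, both with the factor \<open>\<sigma> \<mu>\<close>.
\<close>

lemma pretty_good_state_transfer_corona_K1:
  fixes G :: "'a::finite pair_pre_digraph" and x :: "real \<Rightarrow> complex^'a"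
  assumes G: "pverts G = UNIV" and "finite \<Lambda>"
    and eig: "\<And>\<mu>. \<mu> \<in> \<Lambda> \<Longrightarrow> adjacency_matrix G *v x \<mu> = of_real \<mu> *s x \<mu>"
    and u: "axis u 1 = (\<Sum>\<mu>\<in>\<Lambda>. x \<mu>)"
    and v: "axis v 1 = (\<Sum>\<mu>\<in>\<Lambda>. \<sigma> \<mu> *s x \<mu>)"
    and approx: "\<And>\<delta>. \<delta> > 0 \<Longrightarrow> \<exists>\<tau> \<gamma>. cmod \<gamma> = 1 \<and> (\<forall>\<mu>\<in>\<Lambda>. \<forall>s.
      cmod (exp (- (\<i> * of_real \<tau>) * of_real (corona_eigenvalue \<mu> s)) - \<gamma> * \<sigma> \<mu>) < \<delta>)"
  shows "pretty_good_state_transfer (corona G K1) (u, None) (v, None)"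
proof (rule pretty_good_state_transfer_eigenvectors)
  \<comment> \<open>The two roots for \<open>\<mu>\<close> differ by \<open>sqrt (\<mu>\<^sup>2 + 4)\<close>, so with these factors the two vectors for \<open>\<mu>\<close>
    add up to \<open>x \<mu>\<close> on the vertices \<open>(v, None)\<close> and cancel on the pendant ones.\<close>
  let ?w = "\<lambda>(\<mu>, s). of_real ((if s then 1 else - 1) / sqrt (\<mu>\<^sup>2 + 4)) *s
    corona_vec (of_real (corona_eigenvalue \<mu> s)) (x \<mu>)"
  show "finite (\<Lambda> \<times> (UNIV :: bool set))"
    using \<open>finite \<Lambda>\<close> by simp
  show "adjacency_matrix (corona G K1) *v ?w i = of_real (case_prod corona_eigenvalue i) *s ?w i"
    if i: "i \<in> \<Lambda> \<times> UNIV" for i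
  proof -
    obtain \<mu> s where "i = (\<mu>, s)" "\<mu> \<in> \<Lambda>" using i by auto
    moreover have "(of_real (corona_eigenvalue \<mu> s) * of_real (corona_eigenvalue \<mu> s) :: complex)
        = of_real \<mu> * of_real (corona_eigenvalue \<mu> s) + 1"
      using arg_cong[OF corona_eigenvalue_quadratic, of complex_of_real] by simp
    ultimately show ?thesis
      using corona_K1_eigenvector[OF G eig]
      by (simp add: vector_scalar_commute mult_ac)
  qed
  have root: "sqrt (\<mu>\<^sup>2 + 4) > 0" for \<mu>
    by (simp add: add_nonneg_pos)
  have split: "?w (\<mu>, True) + ?w (\<mu>, False) = (\<chi> p. if snd p = None then x \<mu> $ fst p else 0)" for \<mu>
  proof -
    have "corona_eigenvalue \<mu> True - corona_eigenvalue \<mu> False = sqrt (\<mu>\<^sup>2 + 4)"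
      by (simp add: corona_eigenvalue_def field_simps)
    then have "complex_of_real (corona_eigenvalue \<mu> True) - of_real (corona_eigenvalue \<mu> False)
        = of_real (sqrt (\<mu>\<^sup>2 + 4))"
      by (simp flip: of_real_diff)
    then show ?thesis
      using root[of \<mu>] by (auto simp: vec_eq_iff corona_vec_def field_simps simp flip: left_diff_distrib)
  qed
  have UNIV_bool_sum: "(\<Sum>i\<in>\<Lambda> \<times> UNIV. f i) = (\<Sum>\<mu>\<in>\<Lambda>. f (\<mu>, True) + f (\<mu>, False))"
    for f :: "real \<times> bool \<Rightarrow> complex^('a \<times> unit option)"
    by (simp add: UNIV_bool add.commute sum.cartesian_product')
  have axis_corona: "axis (y, None) 1 = (\<chi> p. if snd p = None then axis y 1 $ fst p else 0)"
    for y :: 'a by (auto simp: axis_def vec_eq_iff)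
  show "axis (u, None) 1 = (\<Sum>i\<in>\<Lambda> \<times> UNIV. ?w i)"
    unfolding UNIV_bool_sum split unfolding axis_corona u by (auto simp: vec_eq_iff)
  show "axis (v, None) 1 = (\<Sum>i\<in>\<Lambda> \<times> UNIV. \<sigma> (fst i) *s ?w i)"
    unfolding UNIV_bool_sum fst_conv vec.scale_right_distrib[symmetric] split
    unfolding axis_corona v by (auto simp: vec_eq_iff intro!: sum.cong)
  show "\<exists>\<tau> \<gamma>. cmod \<gamma> = 1 \<and> (\<forall>i\<in>\<Lambda> \<times> UNIV.
      cmod (exp (- (\<i> * of_real \<tau>) * of_real (case_prod corona_eigenvalue i)) - \<gamma> * \<sigma> (fst i)) < \<delta>)"
    if "\<delta> > 0" for \<delta>
    using approx[OF that] by fastforce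
qed

section \<open>Spectrum of the cocktail party graph\<close>

lemma adjacency_matrix_cocktail_party_mult:
  fixes z :: "complex^('n::finite \<times> bool)"
  shows "(adjacency_matrix cocktail_party *v z) $ (i, s)
    = (\<Sum>q\<in>UNIV. z $ q) - (z $ (i, True) + z $ (i, False))"
proof -
  have "(\<Sum>q\<in>UNIV. z $ q) = (\<Sum>q\<in>{q. fst q \<noteq> i}. z $ q) + (\<Sum>q\<in>{q. fst q = i}. z $ q)"
    by (subst sum.union_disjoint[symmetric]) (auto intro: sum.cong)
  moreover have "{q. fst q = i} = {(i, True), (i, False)}"
    by auto
  moreover have "(adjacency_matrix cocktail_party *v z) $ (i, s) = (\<Sum>q\<in>{q. fst q \<noteq> i}. z $ q)"
    by (simp add: matrix_vector_mult_def adjacency_matrix_def cocktail_party_simps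
        if_distrib[of "\<lambda>a. a * _"] sum.If_cases eq_commute cong: if_cong)
  ultimately show ?thesis by simp
qed

lemma cocktail_party_spectral_decomposition:
  fixes u v :: "'n::finite \<times> bool"
  assumes n: "CARD('n) \<ge> 2" and "antipodal cocktail_party u v"
  obtains x :: "real \<Rightarrow> complex^('n \<times> bool)"
  where "\<And>\<mu>. \<mu> \<in> {-2, 0, 2 * (real CARD('n) - 1)} \<Longrightarrow>
      adjacency_matrix cocktail_party *v x \<mu> = of_real \<mu> *s x \<mu>"
    and "axis u 1 = (\<Sum>\<mu>\<in>{-2, 0, 2 * (real CARD('n) - 1)}. x \<mu>)"
    and "axis v 1 = (\<Sum>\<mu>\<in>{-2, 0, 2 * (real CARD('n) - 1)}. (if \<mu> = 0 then - 1 else 1) *s x \<mu>)"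
proof -
  let ?n = "real CARD('n)" and ?A = "adjacency_matrix (cocktail_party :: ('n \<times> bool) pair_pre_digraph)"
  obtain i b where u: "u = (i, b)" by (cases u)
  have v: "v = (i, \<not> b)"
    using assms(2) u by (cases v) (auto simp: antipodal_cocktail_party(2)[OF n] cocktail_party_simps)
  define j :: "complex^('n \<times> bool)" where "j = (\<chi> p. 1)"
  \<comment> \<open>\<open>x0\<close>, \<open>x1\<close>, \<open>x2\<close> are the components of \<open>e\<^sub>u\<close> for the eigenvalues \<open>0\<close>, \<open>-2\<close>, \<open>2n - 2\<close>;
    the last one is the projection to the constant vectors.\<close>
  define x0 where "x0 = (1/2) *s (axis u 1 - axis v 1 :: complex^('n \<times> bool))"
  define x2 where "x2 = (1 / (2 * of_nat CARD('n))) *s j"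
  define x1 where "x1 = (1/2) *s (axis u 1 + axis v 1) - x2"
  have Aj: "?A *v j = of_real (2 * (?n - 1)) *s j"
    by (auto simp: vec_eq_iff adjacency_matrix_cocktail_party_mult j_def)
  have Ax2: "?A *v x2 = of_real (2 * (?n - 1)) *s x2"
    by (simp add: x2_def vector_scalar_commute Aj) (simp add: vec_eq_iff j_def field_simps)
  have ax: "(\<Sum>q\<in>UNIV. axis p (1 :: complex) $ q) = 1" for p :: "'n \<times> bool"
    by (simp add: axis_def)
  have Ax0: "?A *v x0 = 0"
    by (auto simp: vec_eq_iff adjacency_matrix_cocktail_party_mult x0_def u v sum_subtractf ax
        simp flip: sum_divide_distrib) (auto simp: axis_def)
  have Auv: "?A *v (axis u 1 + axis v 1) = 2 *s j - 2 *s (axis u 1 + axis v 1)"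
    by (auto simp: vec_eq_iff adjacency_matrix_cocktail_party_mult u v sum.distrib ax j_def)
       (auto simp: axis_def)
  have j: "j = (2 * of_nat CARD('n)) *s x2"
    by (simp add: x2_def)
  have Ax1: "?A *v x1 = - 2 *s x1"
    unfolding x1_def matrix_vector_mult_diff_distrib vector_scalar_commute Auv Ax2
    by (simp add: vec_eq_iff j algebra_simps)
  define x where "x \<mu> = (if \<mu> = - 2 then x1 else if \<mu> = 0 then x0 else x2)" for \<mu> :: real
  have distinct: "2 * (?n - 1) \<noteq> 0" "2 * (?n - 1) \<noteq> - 2"
    using n by auto
  show thesis
  proof (rule that[of x])
    show "?A *v x \<mu> = of_real \<mu> *s x \<mu>" if "\<mu> \<in> {-2, 0, 2 * (?n - 1)}" for \<mu>
      using that distinct Ax0 Ax1 Ax2 by (auto simp: x_def)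
    show "axis u 1 = (\<Sum>\<mu>\<in>{-2, 0, 2 * (?n - 1)}. x \<mu>)"
      using distinct by (simp add: x_def) (simp add: x1_def x0_def vec_eq_iff field_simps)
    show "axis v 1 = (\<Sum>\<mu>\<in>{-2, 0, 2 * (?n - 1)}. (if \<mu> = 0 then - 1 else 1) *s x \<mu>)"
      using distinct by (simp add: x_def) (simp add: x1_def x0_def vec_eq_iff field_simps)
  qed
qed

section \<open>Simultaneous approximation of one half\<close>

lemma sqrt_rat_imp_square:
  assumes "sqrt (real N) \<in> \<rat>"
  shows "\<exists>k. N = k\<^sup>2"
proof -
  obtain a b :: nat where "b \<noteq> 0" and ab: "\<bar>sqrt (real N)\<bar> = real a / real b" and "coprime a b"
    using Rats_abs_nat_div_natE[OF assms] by metis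
  have "real a = sqrt (real N) * real b"
    using ab \<open>b \<noteq> 0\<close> by (simp add: field_simps)
  then have "(real a)\<^sup>2 = real N * (real b)\<^sup>2"
    by (simp add: power_mult_distrib)
  then have eq: "a\<^sup>2 = N * b\<^sup>2"
    by (metis of_nat_eq_iff of_nat_mult of_nat_power)
  then have "b\<^sup>2 dvd a\<^sup>2" by simp
  with \<open>coprime a b\<close> have "b = 1"
    by (metis coprime_absorb_right nat_dvd_1_iff_1 pow_divides_pow_iff zero_less_numeral)
  with eq show ?thesis by auto
qed

text \<open>Linear independence of \<open>sqrt 2\<close>, \<open>sqrt M\<close> and \<open>1\<close> over the integers.\<close>

lemma independent_sqrts:
  fixes M :: nat and a b c :: int
  assumes M: "sqrt M \<notin> \<rat>" "sqrt (2 * M) \<notin> \<rat>" and "sqrt 2 \<notin> \<rat>"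
    and eq: "a * sqrt 2 + b * sqrt M + c = 0"
  shows "a = 0 \<and> b = 0 \<and> c = 0"
proof -
  \<comment> \<open>Squaring leaves \<open>2 a b sqrt (2 M)\<close> as the only possibly irrational term.\<close>
  have "a * sqrt 2 + b * sqrt M = - c"
    using eq by simp
  then have "(a * sqrt 2 + b * sqrt M)\<^sup>2 = (- c)\<^sup>2"
    by simp
  then have "2 * a * b * sqrt (2 * M) = c\<^sup>2 - 2 * a\<^sup>2 - b\<^sup>2 * M"
    by (simp add: power2_sum real_sqrt_mult algebra_simps)
  then have product: "sqrt (2 * M) = (c\<^sup>2 - 2 * a\<^sup>2 - b\<^sup>2 * M) / (2 * a * b)" if "a \<noteq> 0" "b \<noteq> 0"
    using that by (simp add: field_simps)
  have "a = 0 \<or> b = 0"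
  proof (rule ccontr)
    assume "\<not> (a = 0 \<or> b = 0)"
    then have "sqrt (2 * M) = (c\<^sup>2 - 2 * a\<^sup>2 - b\<^sup>2 * M) / (2 * a * b)"
      using product by blast
    also have "\<dots> \<in> \<rat>"
      by simp
    finally show False
      using M(2) by contradiction
  qed
  moreover have "a = 0" if "b = 0"
  proof (rule ccontr)
    assume "a \<noteq> 0"
    then have "sqrt 2 = - c / a" using eq that by (simp add: field_simps)
    then show False using assms(3) by simp
  qed
  moreover have "b = 0" if "a = 0"
  proof (rule ccontr)
    assume "b \<noteq> 0"
    then have "sqrt M = - c / b" using eq that by (simp add: field_simps)
    then show False using assms(1) by simp
  qed
  ultimately show ?thesis using eq by auto
qed

lemma approx_half_sqrts:
  fixes M :: nat
  assumes M: "sqrt M \<notin> \<rat>" "sqrt (2 * M) \<notin> \<rat>" and "\<epsilon> > 0"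
  obtains k p q :: int where "\<bar>k * sqrt 2 - p - 1/2\<bar> < \<epsilon>" "\<bar>k * sqrt M - q - 1/2\<bar> < \<epsilon>"
proof -
  have two: "sqrt 2 \<notin> \<rat>"
  proof
    assume "sqrt 2 \<in> \<rat>"
    then obtain k where "2 = (k :: nat)\<^sup>2" using sqrt_rat_imp_square[of 2] by auto
    moreover from this have "k < 2"
      by (intro power_less_imp_less_base[of k 2 2]) simp_all
    ultimately show False
      by (auto simp: less_2_cases_iff)
  qed
  interpret Modules.module "\<lambda>r x. real_of_int r * x"
    by (simp add: Modules.module.intro distrib_left mult.commute)
  define \<theta> :: "nat \<Rightarrow> real" where "\<theta> = (\<lambda>i. if i = 0 then sqrt 2 else if i = 1 then sqrt M else 1)"
  have range: "{..2::nat} = {0, 1, 2}" by auto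
  have ne: "sqrt 2 \<noteq> sqrt M" "sqrt 2 \<noteq> 1" "sqrt M \<noteq> 1"
    using independent_sqrts[OF M two, of 1 "-1" 0] two M by auto
  have "independent (\<theta> ` {..2})"
    unfolding dependent_finite[OF finite_imageI[OF finite_atMost]]
  proof
    assume "\<exists>u. (\<exists>x\<in>\<theta> ` {..2}. u x \<noteq> 0) \<and> (\<Sum>x\<in>\<theta> ` {..2}. real_of_int (u x) * x) = 0"
    then obtain u i where i: "i \<in> {..2}" "u (\<theta> i) \<noteq> 0"
      and sum: "(\<Sum>x\<in>\<theta> ` {..2}. real_of_int (u x) * x) = 0"
      by blast
    have "u (sqrt 2) * sqrt 2 + u (sqrt M) * sqrt M + u 1 = 0"
      using sum ne unfolding range by (simp add: \<theta>_def add.assoc)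
    then have "u (sqrt 2) = 0 \<and> u (sqrt M) = 0 \<and> u 1 = 0"
      by (rule independent_sqrts[OF M two])
    then show False using i by (auto simp: \<theta>_def split: if_splits)
  qed
  moreover have "inj_on \<theta> {..2}"
    unfolding range using ne by (auto simp: \<theta>_def)
  moreover have "\<theta> 2 = 1"
    by (simp add: \<theta>_def)
  ultimately obtain k m where "\<And>i. i < 2 \<Longrightarrow> \<bar>of_int k * \<theta> i - of_int (m i) - 1/2\<bar> < \<epsilon>"
    using Kronecker_thm_2[of \<theta> 2 \<epsilon> "\<lambda>_. 1/2"] \<open>\<epsilon> > 0\<close> by blast
  from this[of 0] this[of 1] show thesis
    by (intro that) (auto simp: \<theta>_def)
qed

text \<open>The first number lies strictly between consecutive squares; the second is \<open>2\<close> modulo \<open>4\<close>.\<close>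

lemma not_square_even_square_plus_one:
  fixes m :: nat
  assumes "m \<noteq> 0"
  shows "\<nexists>k. (2 * m)\<^sup>2 + 1 = k\<^sup>2" and "\<nexists>k. 2 * ((2 * m)\<^sup>2 + 1) = k\<^sup>2"
proof safe
  fix k assume k: "(2 * m)\<^sup>2 + 1 = k\<^sup>2"
  have "(2 * m)\<^sup>2 < k\<^sup>2" using k by simp
  moreover have "k\<^sup>2 < (2 * m + 1)\<^sup>2" using k[symmetric] assms by (simp add: power2_eq_square)
  ultimately show False
    using power_less_imp_less_base[of "2 * m" 2 k] power_less_imp_less_base[of k 2 "2 * m + 1"] by simp
next
  fix k assume k: "2 * ((2 * m)\<^sup>2 + 1) = k\<^sup>2"
  then have "even k" by (metis dvd_triv_left even_power)
  then obtain l where "k = 2 * l" by (elim evenE)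
  with k have "2 * (2 * m\<^sup>2) + 1 = 2 * l\<^sup>2" by (simp add: power2_eq_square)
  then show False by presburger
qed

section \<open>Phases close to minus one\<close>

lemma exp_near_minus_one:
  fixes t \<epsilon> :: real and h :: int
  assumes "\<bar>t - h - 1/2\<bar> \<le> \<epsilon>"
  shows "cmod (exp (- (2 * pi * \<i> * t)) + 1) \<le> 2 * pi * \<epsilon>"
proof -
  define d where "d = t - h - 1/2"
  have "- (2 * pi * \<i> * t) = \<i> * of_real (- 2 * pi * d) + (\<i> * of_real (2 * pi) * of_int (- h) - \<i> * of_real pi)"
    by (simp add: d_def algebra_simps)
  also have "exp \<dots> = - exp (\<i> * of_real (- 2 * pi * d))"
    by (simp add: exp_add exp_diff exp_minus inverse_eq_divide mult_ac)
  finally have "cmod (exp (- (2 * pi * \<i> * t)) + 1) = cmod (exp (\<i> * of_real (- 2 * pi * d)) - 1)"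
    by (simp add: norm_minus_commute)
  also have "\<dots> = 2 * \<bar>sin (- 2 * pi * d / 2)\<bar>"
    by (rule dist_exp_i_1)
  also have "\<dots> \<le> 2 * \<bar>- 2 * pi * d / 2\<bar>"
    by (intro mult_left_mono abs_sin_x_le_abs_x) auto
  also have "\<dots> = 2 * pi * \<bar>d\<bar>"
    by (simp add: abs_mult)
  also have "\<dots> \<le> 2 * pi * \<epsilon>"
    using assms by (simp add: d_def)
  finally show ?thesis .
qed

text \<open>
  The corona eigenvalues for the even integer \<open>\<mu> = 2 a\<close> are \<open>a \<plusminus> \<alpha>\<close>. At time \<open>2 \<pi> k\<close> the integral
  part \<open>a\<close> contributes a full turn, and both signs of \<open>\<alpha>\<close> lead to \<open>-1\<close>, since \<open>1/2\<close> and \<open>-1/2\<close> agree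
  modulo \<open>1\<close>.
\<close>

lemma exp_corona_near_minus_one:
  fixes \<alpha> \<epsilon> :: real and k h a :: int
  assumes "\<bar>k * \<alpha> - h - 1/2\<bar> < \<epsilon>" and "sqrt ((2 * of_int a)\<^sup>2 + 4) = 2 * \<alpha>"
  shows "cmod (exp (- (\<i> * of_real (2 * pi * k)) * of_real (corona_eigenvalue (2 * of_int a) s)) + 1)
    \<le> 2 * pi * \<epsilon>"
proof -
  define h' where "h' = (if s then k * a + h else k * a - h - 1)"
  have "k * corona_eigenvalue (2 * of_int a) s - h' - 1/2
      = (if s then 1 else - 1) * (k * \<alpha> - h - 1/2)"
    using assms(2) by (simp add: corona_eigenvalue_def h'_def field_simps)
  then have "\<bar>k * corona_eigenvalue (2 * of_int a) s - h' - 1/2\<bar> \<le> \<epsilon>"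
    using assms(1) by (cases s) auto
  from exp_near_minus_one[OF this] show ?thesis
    by (simp add: mult_ac)
qed

section \<open>State transfer between antipodal vertices\<close>

theorem theorem5p9:
  fixes n :: nat and u v :: "'n::finite \<times> bool"
  assumes "n = CARD('n)" and "n \<ge> 3" and "odd n"
    and "antipodal (cocktail_party :: ('n \<times> bool) pair_pre_digraph) u v"
  shows "pretty_good_state_transfer
           (corona (cocktail_party :: ('n \<times> bool) pair_pre_digraph) K1) (u, None) (v, None)"
proof -
  let ?\<Lambda> = "{-2, 0, 2 * (real CARD('n) - 1)}"
  have "CARD('n) \<ge> 2" using assms(1,2) by simp
  then obtain x :: "real \<Rightarrow> complex^('n \<times> bool)"
    where eig: "\<And>\<mu>. \<mu> \<in> ?\<Lambda> \<Longrightarrow> adjacency_matrix cocktail_party *v x \<mu> = of_real \<mu> *s x \<mu>"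
      and u: "axis u 1 = (\<Sum>\<mu>\<in>?\<Lambda>. x \<mu>)"
      and v: "axis v 1 = (\<Sum>\<mu>\<in>?\<Lambda>. (if \<mu> = 0 then - 1 else 1) *s x \<mu>)"
    by (rule cocktail_party_spectral_decomposition[OF _ assms(4)]) (rule that)
  obtain m where m: "n = 2 * m + 1" using \<open>odd n\<close> by (elim oddE)
  define M where "M = (2 * m)\<^sup>2 + 1"
  have "m \<noteq> 0" using m assms(2) by auto
  then have irrational: "sqrt M \<notin> \<rat>" "sqrt (2 * M) \<notin> \<rat>"
    using not_square_even_square_plus_one sqrt_rat_imp_square[of M] sqrt_rat_imp_square[of "2 * M"]
    unfolding M_def by auto
  show ?thesis
  proof (rule pretty_good_state_transfer_corona_K1[OF cocktail_party_simps(1) _ eig u v])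
    fix \<delta> :: real
    assume "\<delta> > 0"
    define \<epsilon> where "\<epsilon> = \<delta> / (4 * pi)"
    have \<epsilon>: "\<epsilon> > 0" "2 * pi * \<epsilon> < \<delta>"
      using \<open>\<delta> > 0\<close> by (simp_all add: \<epsilon>_def)
    obtain k p q :: int where k: "\<bar>k * sqrt 2 - p - 1/2\<bar> < \<epsilon>" "\<bar>k * sqrt M - q - 1/2\<bar> < \<epsilon>"
      using approx_half_sqrts[OF irrational \<epsilon>(1)] .
    let ?e = "\<lambda>\<mu> s. exp (- (\<i> * of_real (2 * pi * k)) * of_real (corona_eigenvalue \<mu> s))"
    have "cmod (?e \<mu> s - (- 1) * (if \<mu> = 0 then - 1 else 1)) < \<delta>" if \<mu>: "\<mu> \<in> ?\<Lambda>" for \<mu> s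
    proof -
      consider "\<mu> = - 2" | "\<mu> = 0" | "\<mu> = 2 * (real CARD('n) - 1)" "\<mu> \<noteq> 0"
        using \<mu> by blast
      then show ?thesis
      proof cases
        case 1
        have "sqrt 8 = sqrt (2\<^sup>2 * 2)" by simp
        also have "\<dots> = 2 * sqrt 2" by (simp only: real_sqrt_mult real_sqrt_abs abs_numeral)
        finally have "sqrt ((2 * of_int (- 1))\<^sup>2 + 4) = 2 * sqrt 2" by simp
        from exp_corona_near_minus_one[OF k(1) this, of s] show ?thesis
          using 1 \<epsilon>(2) by simp
      next
        case 2
        have "corona_eigenvalue \<mu> s = (if s then 1 else - 1)"
          using 2 by (simp add: corona_eigenvalue_def)
        then have "?e \<mu> s = exp (\<i> * (of_int (if s then - k else k) * (of_real pi * 2)))"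
          by (simp add: mult_ac)
        also have "\<dots> = 1"
          by (rule exp_2pi_1_int)
        finally show ?thesis using 2 \<open>\<delta> > 0\<close> by simp
      next
        case 3
        have \<mu>_eq: "\<mu> = 2 * of_int (2 * int m)"
          using 3 m assms(1) by simp
        have "(2 * real_of_int (2 * int m))\<^sup>2 + 4 = 2\<^sup>2 * real M"
          by (simp add: M_def algebra_simps)
        then have "sqrt ((2 * of_int (2 * int m))\<^sup>2 + 4) = 2 * sqrt M"
          by (simp only: real_sqrt_mult real_sqrt_abs abs_numeral)
        from exp_corona_near_minus_one[OF k(2) this, of s] show ?thesis
          using 3(2) \<epsilon>(2) unfolding \<mu>_eq by simp
      qed
    qed
    then show "\<exists>\<tau> \<gamma>. cmod \<gamma> = 1 \<and> (\<forall>\<mu>\<in>?\<Lambda>. \<forall>s.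
        cmod (exp (- (\<i> * of_real \<tau>) * of_real (corona_eigenvalue \<mu> s))
          - \<gamma> * (if \<mu> = 0 then - 1 else 1)) < \<delta>)"
      by (intro exI[of _ "2 * pi * k"] exI[of _ "- 1"]) simp
  qed auto
qed

end
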